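(* Let $\mathbf{Z}\in\mathbb{R}^6$ be a fixed parameter. For $\mathbf{X}\in\mathbb{R}^6$ put $\mathbf{Z}_i:=\mathbf{P}_i(\mathbf{X})\mathbf{Z}$ and, for $0\le j\le i-1$, $$\mathbf{P}_{i,j}(\mathbf{X},\mathbf{Z}):=-\mathbf{P}_j(\mathbf{X})\,\mathbf{ad}_{\mathbf{Z}_{i-j-1}}.$$ The Jacobians of the evaluation maps $f(\mathbf{X})=\mathbf{dexp}_{\mathbf{X}}\mathbf{Z}$ and $f^{\mathrm{inv}}(\mathbf{X})=\mathbf{dexp}_{\mathbf{X}}^{-1}\mathbf{Z}$ possess the series expansions $$\frac{\partial f}{\partial\mathbf{X}}=\sum_{i=0}^\infty\frac1{(i+1)!}\sum_{j=0}^{i-1}\mathbf{P}_{i,j}(\mathbf{X},\mathbf{Z}),\qquad \frac{\partial f^{\mathrm{inv}}}{\partial\mathbf{X}}=\sum_{i=0}^\infty\frac{B_i}{i!}\sum_{j=0}^{i-1}\mathbf{P}_{i,j}(\mathbf{X},\mathbf{Z}).$$ Moreover, the matrices $\mathbf{P}_{i,j}$ satisfy the recursive relation (for $0\le j\le i-2$, so that $\mathbf{Z}_{i-j-2}$ is defined) $$\mathbf{P}_{i,j}(\mathbf{X},\mathbf{Z})=\mathbf{ad}_{\mathbf{X}}\mathbf{P}_{i-1,j}(\mathbf{X},\mathbf{Z})+\mathbf{P}_j(\mathbf{X})\,\mathbf{ad}_{\mathbf{Z}_{i-j-2}}\mathbf{ad}_{\mathbf{X}}.$$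
   Context: For $\mathbf{x}\in\mathbb{R}^3$, $\tilde{\mathbf{x}}$ is the skew-symmetric matrix with $\tilde{\mathbf{x}}\mathbf{w}=\mathbf{x}\times\mathbf{w}$. For $\mathbf{X}=(\mathbf{x},\mathbf{y})\in\mathbb{R}^3\times\mathbb{R}^3\cong se(3)$, $\mathbf{ad}_{\mathbf{X}}=\begin{bmatrix}\tilde{\mathbf{x}}&\mathbf{0}\\ \tilde{\mathbf{y}}&\tilde{\mathbf{x}}\end{bmatrix}$ and $\mathbf{P}_i(\mathbf{X}):=\mathbf{ad}_{\mathbf{X}}^i$ ($\mathbf{P}_0=\mathbf{I}$). The $6\times 6$ matrix $\mathbf{dexp}_{\mathbf{X}}$ of the right-trivialized differential of $\exp$ on $SE(3)$ and its inverse admit the series expansions $\mathbf{dexp}_{\mathbf{X}}=\sum_{i=0}^\infty\frac1{(i+1)!}\mathbf{ad}_{\mathbf{X}}^i$ and $\mathbf{dexp}_{\mathbf{X}}^{-1}=\sum_{i=0}^\infty\frac{B_i}{i!}\mathbf{ad}_{\mathbf{X}}^i$, where $B_i$ are the Bernoulli numbers with $B_0=1$, $B_1=-\frac12$, $B_2=\frac16$. The Jacobian $\frac{\partial f}{\partial\mathbf{X}}$ is the $6\times6$ matrix with $\frac{\partial f}{\partial\mathbf{X}}\mathbf{U}=\frac{d}{dt}f(\mathbf{X}+t\mathbf{U})|_{t=0}$ for $\mathbf{U}\in\mathbb{R}^6$. Empty sums are zero.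
   Formalization: The expansion of the Jacobian of f^inv is asserted only for X=(x,y) with ||x||<2π; for ||x||≥2π the Bernoulli series diverges for every Z≠0 (e.g. x=(3π,0,0), y=0, Z=X), so the unrestricted claim is false. *)

theory Defs
  imports "HOL-Analysis.Analysis"
begin

(* Indexing by the sum type 3 + 3 makes the block structure explicit:
   Inl addresses the first (angular) and Inr the second (linear) copy of R^3. *)
type_synonym vec6 = "real ^ (3 + 3)"
type_synonym mat6 = "real ^ (3 + 3) ^ (3 + 3)"
type_synonym mat4 = "real ^ (3 + 1) ^ (3 + 1)"

definition ang :: "vec6 \<Rightarrow> real ^ 3" where
  "ang X = (\<chi> i. X $ Inl i)"

definition lin :: "vec6 \<Rightarrow> real ^ 3" where
  "lin X = (\<chi> i. X $ Inr i)"

definition skew :: "real ^ 3 \<Rightarrow> real ^ 3 ^ 3" where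
  "skew x = matrix (cross3 x)"

lemma skew_mult_vec: "skew x *v w = cross3 x w"
  by (simp add: skew_def matrix_def matrix_vector_mult_def cross3_def vec_eq_iff
      forall_3 sum_3 axis_def vector_3 algebra_simps)

definition block_matrix ::
  "real ^ 'c ^ 'a \<Rightarrow> real ^ 'd ^ 'a \<Rightarrow> real ^ 'c ^ 'b \<Rightarrow> real ^ 'd ^ 'b
     \<Rightarrow> real ^ ('c + 'd) ^ ('a + 'b)" where
  "block_matrix A B C D =
     (\<chi> i j. case i of
        Inl r \<Rightarrow> (case j of Inl s \<Rightarrow> A $ r $ s | Inr s \<Rightarrow> B $ r $ s)
      | Inr r \<Rightarrow> (case j of Inl s \<Rightarrow> C $ r $ s | Inr s \<Rightarrow> D $ r $ s))"

definition ad :: "vec6 \<Rightarrow> mat6" where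
  "ad X = block_matrix (skew (ang X)) 0 (skew (lin X)) (skew (ang X))"

lemma sum_UNIV_sum_type:
  fixes f :: "'a::finite + 'b::finite \<Rightarrow> 'c::comm_monoid_add"
  shows "sum f UNIV = (\<Sum>i\<in>UNIV. f (Inl i)) + (\<Sum>i\<in>UNIV. f (Inr i))"
  by (subst UNIV_Plus_UNIV[symmetric], subst sum.Plus) (simp_all add: o_def)

lemma ang_ad: "ang (ad X *v Y) = cross3 (ang X) (ang Y)"
  unfolding skew_mult_vec[symmetric]
  by (simp add: vec_eq_iff ang_def ad_def block_matrix_def matrix_vector_mult_def
      sum_UNIV_sum_type)

lemma lin_ad: "lin (ad X *v Y) = cross3 (lin X) (ang Y) + cross3 (ang X) (lin Y)"
  unfolding skew_mult_vec[symmetric]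
  by (simp add: vec_eq_iff ang_def lin_def ad_def block_matrix_def matrix_vector_mult_def
      sum_UNIV_sum_type)

(* The power A ^ n is not available for this: the ring multiplication that the
   library puts on vectors and matrices is the componentwise one. *)
primrec matrix_power :: "real ^ 'n ^ 'n \<Rightarrow> nat \<Rightarrow> real ^ 'n ^ 'n" where
  "matrix_power A 0 = mat 1"
| "matrix_power A (Suc n) = A ** matrix_power A n"

definition matrix_exp :: "real ^ 'n ^ 'n \<Rightarrow> real ^ 'n ^ 'n" where
  "matrix_exp A = (\<Sum>n. (1 / fact n) *\<^sub>R matrix_power A n)"

(* The isomorphism of R^3 x R^3 with the matrix Lie algebra se(3). *)
definition se3_hat :: "vec6 \<Rightarrow> mat4" where
  "se3_hat X = block_matrix (skew (ang X)) (\<chi> i j. lin X $ i) 0 0"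

lemma inj_se3_hat: "inj se3_hat"
proof (rule injI)
  fix X Y :: vec6
  assume eq: "se3_hat X = se3_hat Y"
  have r: "se3_hat X $ Inl i $ Inl j = se3_hat Y $ Inl i $ Inl j"
    and t: "se3_hat X $ Inl i $ Inr k = se3_hat Y $ Inl i $ Inr k" for i j k
    using eq by simp_all
  have "lin X = lin Y"
    using t by (simp add: se3_hat_def block_matrix_def vec_eq_iff)
  moreover have "skew (ang X) = skew (ang Y)"
    using r by (simp add: se3_hat_def block_matrix_def vec_eq_iff)
  then have "cross3 (ang X) w = cross3 (ang Y) w" for w
    by (metis skew_mult_vec)
  then have "cross3 (ang X - ang Y) w = 0" for w
    by (simp add: cross3_def vec_eq_iff forall_3 algebra_simps)
  then have "ang X = ang Y"
    using cross_basis_nonzero[of "ang X - ang Y"] by fastforce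
  ultimately show "X = Y"
    unfolding ang_def lin_def vec_eq_iff by (metis (mono_tags) sumE vec_lambda_beta)
qed

lemma se3_hat_ad: "se3_hat (ad X *v Y) = se3_hat X ** se3_hat Y - se3_hat Y ** se3_hat X"
  unfolding vec_eq_iff split_sum_all forall_3
  by (simp add: se3_hat_def ang_ad lin_ad block_matrix_def matrix_matrix_mult_def
      sum_UNIV_sum_type skew_def matrix_def cross3_def axis_def sum_3 vector_3 algebra_simps)

definition SE3_exp :: "vec6 \<Rightarrow> mat4" where
  "SE3_exp X = matrix_exp (se3_hat X)"

(* Right-trivialized differential: (D exp)(X) U = se3_hat (dexp X *v U) ** exp X. *)
definition dexp :: "vec6 \<Rightarrow> mat6" where
  "dexp X = matrix (\<lambda>U. inv se3_hat
     (frechet_derivative SE3_exp (at X) U ** matrix_inv (SE3_exp X)))"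

(* dexp X is invertible unless norm (ang X) is a nonzero multiple of 2 * pi.  The nonzero
   eigenvalues of ad X are \<plusminus> i * norm (ang X), so the Bernoulli series of the inverse
   converges exactly when norm (ang X) < 2 * pi. *)
definition dexp_inv :: "vec6 \<Rightarrow> mat6" where
  "dexp_inv X = matrix_inv (dexp X)"

(* Convention B_1 = -1/2. *)
fun bernoulli :: "nat \<Rightarrow> real" where
  "bernoulli n = (if n = 0 then 1
     else - (\<Sum>k<n. real (Suc n choose k) * bernoulli k) / real (Suc n))"

declare bernoulli.simps [simp del]

lemma bernoulli_values: "bernoulli 0 = 1" "bernoulli 1 = - 1 / 2" "bernoulli 2 = 1 / 6"
  by (simp_all add: bernoulli.simps[of 0] bernoulli.simps[of 1] bernoulli.simps[of "Suc 0"]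
      bernoulli.simps[of 2] bernoulli.simps[of "Suc (Suc 0)"] numeral_2_eq_2 numeral_eq_Suc
      lessThan_Suc field_simps)

definition P :: "nat \<Rightarrow> vec6 \<Rightarrow> mat6" where
  "P i X = matrix_power (ad X) i"

definition Zs :: "nat \<Rightarrow> vec6 \<Rightarrow> vec6 \<Rightarrow> vec6" where
  "Zs i X Z = P i X *v Z"

(* Meant for j < i only; otherwise the natural-number subtraction truncates. *)
definition PP :: "nat \<Rightarrow> nat \<Rightarrow> vec6 \<Rightarrow> vec6 \<Rightarrow> mat6" where
  "PP i j X Z = - (P j X ** ad (Zs (i - j - 1) X Z))"

definition has_jacobian :: "(vec6 \<Rightarrow> vec6) \<Rightarrow> mat6 \<Rightarrow> vec6 \<Rightarrow> bool" where
  "has_jacobian f J X \<longleftrightarrow>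
     (\<forall>U. ((\<lambda>t. f (X + t *\<^sub>R U)) has_vector_derivative (J *v U)) (at 0))"

end

theory Submission
  imports Defs "HOL-Complex_Analysis.Cauchy_Integral_Formula"
begin

text \<open>
  Both Jacobians come from one fact about power series. For real coefficients \<open>a\<close>, the derivative
  of \<open>Y \<mapsto> \<Sum>\<^sub>i a\<^sub>i ad\<^sub>Y\<^sup>i Z\<close> at \<open>X\<close> in the direction \<open>U\<close> is, by the product rule, the sum over
  \<open>i\<close> and \<open>j < i\<close> of the terms \<open>a\<^sub>i ad\<^sub>X\<^sup>j ad\<^sub>U Z\<^sub>i\<^sub>-\<^sub>j\<^sub>-\<^sub>1\<close>. Since \<open>ad\<^sub>U W = - ad\<^sub>W U\<close>, such a term is
  \<open>a\<^sub>i P\<^sub>i\<^sub>,\<^sub>j U\<close>, which is the asserted series. The lemma \<open>has_derivative_ad_series\<close> makes this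
  rigorous whenever the angular part of \<open>X\<close> is shorter than the radius of convergence of \<open>a\<close>.

  Only the angular part counts because \<open>ad\<^sub>X\<close> is block triangular and its diagonal blocks do not
  involve the linear part. This is exploited without any spectral theory: the norm
  \<open>N (x, y) = |x| + s |y|\<close> satisfies \<open>N (ad\<^sub>X V) \<le> N X * N V\<close>, and for small \<open>s\<close> the value \<open>N X\<close> is as close to the length of the
  angular part as desired. On the convex open set where \<open>N\<close> is below some number smaller than the
  radius, the differentiated series is dominated by a convergent numerical series, so it may be
  differentiated term by term.

  It remains to see that \<open>dexp\<close> and its inverse are such power series. The derivative of the matrix
  exponential is \<open>\<Sum>\<^sub>n (1/n!) \<Sum>\<^sub>j A\<^sup>j H A\<^sup>n\<^sup>-\<^sup>1\<^sup>-\<^sup>j\<close>. Left multiplication by \<open>A\<close> is right multiplication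
  plus the commutator with \<open>A\<close>, and the two summands commute; expanding binomially turns the series
  into the Cauchy product of \<open>\<Sum>\<^sub>k [A, \<dots>, [A, H]] / (k+1)!\<close> with \<open>exp A\<close>. The commutators are the
  images of powers of \<open>ad\<close> under the isomorphism with se(3), which identifies \<open>dexp\<close>
  (\<open>dexp_eq_series\<close>). The numbers \<open>B\<^sub>n / n!\<close> are by definition the coefficients of the reciprocal of
  \<open>\<Sum>\<^sub>k z\<^sup>k / (k+1)! = (exp z - 1) / z\<close>. That function has no zero with \<open>|z| < 2\<pi>\<close>, so the reciprocal
  series converges there, and substituting \<open>ad\<^sub>X\<close> yields the inverse matrix (\<open>dexp_inv_eq_series\<close>).

  The recursion is the Jacobi identity \<open>ad (ad\<^sub>X V) = ad\<^sub>X ad\<^sub>V - ad\<^sub>V ad\<^sub>X\<close> for \<open>V = Z\<^sub>i\<^sub>-\<^sub>j\<^sub>-\<^sub>2\<close>,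
  multiplied by \<open>P\<^sub>j\<close>, which commutes with \<open>ad\<^sub>X\<close>.
\<close>

section \<open>Matrix multiplication as a bounded bilinear map\<close>

interpretation matrix_mult: bounded_bilinear
  "(**) :: real ^ 'n ^ 'm \<Rightarrow> real ^ 'p ^ 'n \<Rightarrow> real ^ 'p ^ 'm"
  unfolding bilinear_conv_bounded_bilinear[symmetric] bilinear_def
  by (auto intro!: linearI simp: matrix_matrix_mult_def vec_eq_iff
      sum.distrib sum_distrib_left algebra_simps)

interpretation matrix_vec: bounded_bilinear
  "(*v) :: real ^ 'n ^ 'm \<Rightarrow> real ^ 'n \<Rightarrow> real ^ 'm"
  unfolding bilinear_conv_bounded_bilinear[symmetric] bilinear_def
  by (auto intro!: linearI simp: matrix_vector_mult_def vec_eq_iff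
      sum.distrib sum_distrib_left algebra_simps)

lemma sums_entrywise:
  fixes A :: "nat \<Rightarrow> real ^ 'n ^ 'm"
  assumes "\<And>i k. (\<lambda>n. A n $ i $ k) sums (S $ i $ k)"
  shows "A sums S"
  unfolding sums_def
  by (intro vec_tendstoI) (use assms in \<open>simp add: sums_def\<close>)

lemma sums_entry:
  fixes A :: "nat \<Rightarrow> real ^ 'n ^ 'm"
  assumes "A sums S"
  shows "(\<lambda>n. A n $ i $ k) sums (S $ i $ k)"
  by (intro bounded_linear.sums[OF bounded_linear_vec_nth] assms)

lemma summable_norm_entry:
  fixes A :: "nat \<Rightarrow> real ^ 'n ^ 'm"
  assumes "summable (\<lambda>n. norm (A n))"
  shows "summable (\<lambda>n. norm (A n $ i $ k))"
  by (rule summable_comparison_test'[OF assms])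
    (metis Finite_Cartesian_Product.norm_nth_le norm_ge_zero real_norm_def abs_of_nonneg order_trans)

text \<open>
  An entry of a matrix product is a finite sum of products of entries, and each of these is
  covered by the Cauchy product theorem for real series.
\<close>

lemma Cauchy_product_matrix:
  fixes a :: "nat \<Rightarrow> real ^ 'n ^ 'm" and b :: "nat \<Rightarrow> real ^ 'p ^ 'n"
  assumes a: "summable (\<lambda>n. norm (a n))" and b: "summable (\<lambda>n. norm (b n))"
  shows "(\<lambda>n. \<Sum>k\<le>n. a k ** b (n - k)) sums ((\<Sum>n. a n) ** (\<Sum>n. b n))"
proof (rule sums_entrywise)
  fix i j
  have a_entry: "(\<Sum>n. a n $ i $ l) = (\<Sum>n. a n) $ i $ l" for l
    using sums_entry[OF summable_sums[OF summable_norm_cancel[OF a]]] by (simp add: sums_iff)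
  have b_entry: "(\<Sum>n. b n $ l $ j) = (\<Sum>n. b n) $ l $ j" for l
    using sums_entry[OF summable_sums[OF summable_norm_cancel[OF b]]] by (simp add: sums_iff)
  have "(\<lambda>n. \<Sum>l\<in>UNIV. \<Sum>k\<le>n. a k $ i $ l * b (n - k) $ l $ j) sums
      (\<Sum>l\<in>UNIV. (\<Sum>n. a n $ i $ l) * (\<Sum>n. b n $ l $ j))"
    by (intro sums_sum Cauchy_product_sums summable_norm_entry a b)
  then show "(\<lambda>n. (\<Sum>k\<le>n. a k ** b (n - k)) $ i $ j) sums
      (((\<Sum>n. a n) ** (\<Sum>n. b n)) $ i $ j)"
    unfolding a_entry b_entry by (subst (asm) sum.swap) (simp add: matrix_matrix_mult_def)
qed

text \<open>
  Bounds on powers of \<open>ad\<close> are obtained vector by vector; this carries them over to matrices. The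
  constant is crude, which is harmless because it is the same for all terms of a series.
\<close>

lemma norm_matrix_le:
  fixes A :: "real ^ 'n ^ 'm"
  assumes "\<And>v. norm (A *v v) \<le> c * norm v"
  shows "norm A \<le> real CARD('m) * real CARD('n) * c"
proof -
  have entry: "\<bar>A $ i $ k\<bar> \<le> c" for i k
  proof -
    have "\<bar>A $ i $ k\<bar> = norm ((A *v axis k 1) $ i)"
      by (simp add: matrix_vector_mult_basis column_def)
    also have "\<dots> \<le> norm (A *v axis k 1)"
      by (rule Finite_Cartesian_Product.norm_nth_le)
    also have "\<dots> \<le> c"
      using assms[of "axis k 1"] by simp
    finally show ?thesis .
  qed
  have "norm A \<le> (\<Sum>i\<in>UNIV. norm (A $ i))"
    unfolding norm_vec_def by (rule L2_set_le_sum) simp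
  also have "\<dots> \<le> (\<Sum>i::'m\<in>UNIV. \<Sum>k::'n\<in>UNIV. c)"
    by (intro sum_mono order_trans[OF norm_le_l1_cart] entry)
  finally show ?thesis
    by simp
qed

lemma matrix_inv_eqI:
  fixes A :: "real ^ 'n ^ 'n"
  assumes "A ** B = mat 1"
  shows "matrix_inv A = B"
proof -
  have BA: "B ** A = mat 1"
    using assms matrix_left_right_inverse by blast
  have "A ** matrix_inv A = mat 1 \<and> matrix_inv A ** A = mat 1"
    unfolding matrix_inv_def by (rule someI[of _ B]) (simp add: assms BA)
  then show ?thesis
    by (metis BA matrix_mul_assoc matrix_mul_lid matrix_mul_rid)
qed

section \<open>Powers of a matrix and their derivatives\<close>

lemma matrix_power_add:
  "matrix_power A (m + n) = matrix_power A m ** matrix_power A n"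
  by (induction m) (simp_all add: matrix_mul_assoc)

lemma matrix_power_commute: "matrix_power A n ** A = A ** matrix_power A n"
  using matrix_power_add[of A n 1] by simp

text \<open>
  The directional derivative of the \<open>n\<close>-th power at \<open>A\<close> along \<open>H\<close>. The factors do not commute, so
  each position of \<open>H\<close> in the word contributes its own term.
\<close>

definition matrix_power_deriv :: "real ^ 'n ^ 'n \<Rightarrow> real ^ 'n ^ 'n \<Rightarrow> nat \<Rightarrow> real ^ 'n ^ 'n" where
  "matrix_power_deriv A H n =
     (\<Sum>j<n. matrix_power A j ** H ** matrix_power A (n - Suc j))"

lemma matrix_power_deriv_0 [simp]: "matrix_power_deriv A H 0 = 0"
  by (simp add: matrix_power_deriv_def)

lemma matrix_power_deriv_Suc:
  "matrix_power_deriv A H (Suc n) = H ** matrix_power A n + A ** matrix_power_deriv A H n"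
  by (simp add: matrix_power_deriv_def sum.lessThan_Suc_shift matrix_mult.sum_right
      matrix_mul_assoc del: sum.lessThan_Suc)

lemma has_derivative_matrix_power:
  "((\<lambda>A. matrix_power A n) has_derivative (\<lambda>H. matrix_power_deriv A H n)) (at A)"
proof (induction n)
  case (Suc n)
  show ?case
    using matrix_mult.FDERIV[OF has_derivative_ident Suc]
    by (simp add: matrix_power_deriv_Suc add.commute)
qed simp

text \<open>
  Here \<open>\<beta> k\<close> is the \<open>k\<close>-fold commutator of \<open>A\<close> with \<open>\<beta> 0\<close>. Let \<open>L\<close> and \<open>R\<close> be left and right
  multiplication by \<open>A\<close>, and \<open>D = L - R\<close>. All three commute, and the left-hand side is
  \<open>\<Sum>\<^sub>j L\<^sup>j R\<^sup>n\<^sup>-\<^sup>j = ((R + D)\<^sup>n\<^sup>+\<^sup>1 - R\<^sup>n\<^sup>+\<^sup>1) / D\<close> applied to \<open>\<beta> 0\<close>; the right-hand side is its binomial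
  expansion. The induction replaces the formal division by \<open>D\<close>.
\<close>

lemma matrix_power_deriv_commutators:
  fixes A :: "real ^ 'n ^ 'n"
  assumes \<beta>: "\<And>k. \<beta> (Suc k) = A ** \<beta> k - \<beta> k ** A"
  shows "matrix_power_deriv A (\<beta> 0) (Suc n) =
    (\<Sum>k\<le>n. real (Suc n choose Suc k) *\<^sub>R (\<beta> k ** matrix_power A (n - k)))"
proof (induction n)
  case 0
  show ?case by (simp add: matrix_power_deriv_Suc)
next
  case (Suc n)
  define T where "T k = \<beta> k ** matrix_power A (Suc n - k)" for k
  have step: "A ** (\<beta> k ** matrix_power A (n - k)) = T (Suc k) + T k" if "k \<le> n" for k
  proof -
    have "A ** \<beta> k = \<beta> (Suc k) + \<beta> k ** A"
      by (simp add: \<beta>)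
    then show ?thesis
      using that by (simp add: T_def matrix_mul_assoc matrix_mult.add_left Suc_diff_le
          flip: matrix_power.simps(2))
        (simp flip: matrix_mul_assoc)
  qed
  have "matrix_power_deriv A (\<beta> 0) (Suc (Suc n)) =
      T 0 + (\<Sum>k\<le>n. real (Suc n choose Suc k) *\<^sub>R (T (Suc k) + T k))"
    unfolding matrix_power_deriv_Suc[of _ _ "Suc n"] Suc matrix_mult.sum_right
      matrix_mult.scaleR_right
    using step by (simp add: T_def)
  also have "\<dots> = (\<Sum>k\<le>Suc n. real (Suc n choose k) *\<^sub>R T k) +
      (\<Sum>k\<le>Suc n. real (Suc n choose Suc k) *\<^sub>R T k)"
    by (subst sum.atMost_Suc_shift) (simp add: scaleR_add_right sum.distrib binomial_eq_0)
  also have "\<dots> = (\<Sum>k\<le>Suc n. real (Suc (Suc n) choose Suc k) *\<^sub>R T k)"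
    by (simp only: sum.distrib[symmetric] scaleR_left.add[symmetric] of_nat_add[symmetric]
        binomial_Suc_Suc)
  finally show ?case
    by (simp only: T_def)
qed

section \<open>Power series in a matrix\<close>

definition matrix_series :: "(nat \<Rightarrow> real) \<Rightarrow> real ^ 'n ^ 'n \<Rightarrow> real ^ 'n ^ 'n" where
  "matrix_series a A = (\<Sum>n. a n *\<^sub>R matrix_power A n)"

text \<open>
  Powers of a single matrix commute, so an identity between formal power series survives the
  substitution of a matrix as soon as the series converge absolutely.
\<close>

lemma matrix_series_mult_inverse:
  fixes A :: "real ^ 'n ^ 'n"
  assumes a: "summable (\<lambda>n. norm (a n *\<^sub>R matrix_power A n))"
    and b: "summable (\<lambda>n. norm (b n *\<^sub>R matrix_power A n))"
    and conv: "\<And>n. (\<Sum>k\<le>n. a k * b (n - k)) = (if n = 0 then 1 else 0)"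
  shows "matrix_series a A ** matrix_series b A = mat 1"
proof -
  have "(\<Sum>k\<le>n. (a k *\<^sub>R matrix_power A k) ** (b (n - k) *\<^sub>R matrix_power A (n - k))) =
      (if n = 0 then mat 1 else 0)" for n
  proof -
    have "(\<Sum>k\<le>n. (a k *\<^sub>R matrix_power A k) ** (b (n - k) *\<^sub>R matrix_power A (n - k))) =
        (\<Sum>k\<le>n. (a k * b (n - k)) *\<^sub>R matrix_power A n)"
      by (intro sum.cong refl)
        (simp add: matrix_mult.scaleR_left matrix_mult.scaleR_right flip: matrix_power_add)
    also have "\<dots> = (if n = 0 then 1 else 0) *\<^sub>R matrix_power A n"
      by (simp only: scaleR_left.sum[symmetric] conv)
    finally show ?thesis by simp
  qed
  with Cauchy_product_matrix[OF a b]
  have "(\<lambda>n. if n = 0 then mat 1 else 0) sums (matrix_series a A ** matrix_series b A)"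
    by (simp add: matrix_series_def)
  moreover have "(\<lambda>n. if n = 0 then mat 1 else 0 :: real ^ 'n ^ 'n) sums mat 1"
    using sums_If_finite[of "\<lambda>n. n = 0" "\<lambda>n. mat 1 :: real ^ 'n ^ 'n"] by simp
  ultimately show ?thesis
    by (rule sums_unique2)
qed

text \<open>
  The Weierstrass criterion for term-by-term differentiation: a common bound on the operator norms
  of the derivatives makes their series converge uniformly on \<open>S\<close>.
\<close>

lemma has_derivative_series_M_test:
  fixes f :: "nat \<Rightarrow> 'a::real_normed_vector \<Rightarrow> 'b::banach"
  assumes S: "convex S" "open S" "x \<in> S"
    and der: "\<And>n y. y \<in> S \<Longrightarrow> (f n has_derivative f' n y) (at y)"
    and bound: "\<And>n y h. y \<in> S \<Longrightarrow> norm (f' n y h) \<le> M n * norm h"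
    and M: "summable M"
    and f: "summable (\<lambda>n. f n x)"
  shows "((\<lambda>y. \<Sum>n. f n y) has_derivative (\<lambda>h. \<Sum>n. f' n x h)) (at x)"
proof -
  have summable_norm_f': "summable (\<lambda>n. norm (f' n y h))" if "y \<in> S" for y h
    by (rule summable_comparison_test'[OF summable_mult2[OF M, of "norm h"]])
      (use bound[OF that] in simp)
  have tail: "norm ((\<Sum>i<n. f' i y h) - (\<Sum>i. f' i y h)) \<le> (\<Sum>i. M (i + n)) * norm h"
    if "y \<in> S" for n y and h :: 'a
  proof -
    have sm: "summable (\<lambda>i. norm (f' (i + n) y h))"
      using summable_norm_f'[OF that] by (rule summable_ignore_initial_segment)
    have "(\<Sum>i. f' i y h) = (\<Sum>i. f' (i + n) y h) + (\<Sum>i<n. f' i y h)"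
      by (rule suminf_split_initial_segment) (rule summable_norm_cancel[OF summable_norm_f'[OF that]])
    then have "norm ((\<Sum>i<n. f' i y h) - (\<Sum>i. f' i y h)) = norm (\<Sum>i. f' (i + n) y h)"
      by simp
    also have "\<dots> \<le> (\<Sum>i. norm (f' (i + n) y h))"
      by (rule summable_norm[OF sm])
    also have "\<dots> \<le> (\<Sum>i. M (i + n) * norm h)"
      by (intro suminf_le bound that sm summable_mult2 summable_ignore_initial_segment M)
    also have "\<dots> = (\<Sum>i. M (i + n)) * norm h"
      by (rule suminf_mult2[symmetric]) (intro summable_ignore_initial_segment M)
    finally show ?thesis .
  qed
  have "\<exists>g. \<forall>y\<in>S. (\<lambda>n. f n y) sums g y \<and> (g has_derivative (\<lambda>h. \<Sum>n. f' n y h)) (at y within S)"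
  proof (rule has_derivative_series[where f' = f' and x = x])
    show "(\<lambda>n. f n x) sums (\<Sum>n. f n x)"
      using f by (rule summable_sums)
  next
    show "(f n has_derivative f' n y) (at y within S)" if "y \<in> S" for n y
      using der[OF that] by (rule has_derivative_at_withinI)
  next
    fix e :: real assume "e > 0"
    obtain N where N: "\<And>n. n \<ge> N \<Longrightarrow> norm (\<Sum>i. M (i + n)) < e"
      using suminf_exist_split[OF \<open>e > 0\<close> M] by blast
    show "\<forall>\<^sub>F n in sequentially. \<forall>y\<in>S. \<forall>h.
        norm ((\<Sum>i<n. f' i y h) - (\<Sum>i. f' i y h)) \<le> e * norm h"
      unfolding eventually_sequentially
    proof (intro exI[of _ N] allI impI ballI)
      fix n y and h :: 'a assume "N \<le> n" "y \<in> S"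
      have "(\<Sum>i. M (i + n)) * norm h \<le> e * norm h"
        using N[OF \<open>N \<le> n\<close>] by (intro mult_right_mono) auto
      with tail[OF \<open>y \<in> S\<close>, where n = n and h = h]
      show "norm ((\<Sum>i<n. f' i y h) - (\<Sum>i. f' i y h)) \<le> e * norm h"
        by linarith
    qed
  qed (use S in auto)
  then obtain g where sums: "\<And>y. y \<in> S \<Longrightarrow> (\<lambda>n. f n y) sums g y"
    and g: "(g has_derivative (\<lambda>h. \<Sum>n. f' n x h)) (at x within S)"
    using \<open>x \<in> S\<close> by blast
  have "(g has_derivative (\<lambda>h. \<Sum>n. f' n x h)) (at x)"
    using g at_within_open[OF \<open>x \<in> S\<close> \<open>open S\<close>] by simp
  then show ?thesis
    by (rule has_derivative_transform_within_open[OF _ \<open>open S\<close> \<open>x \<in> S\<close>])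
      (use sums in \<open>simp add: sums_iff\<close>)
qed

lemma conv_radius_inverse_fact: "conv_radius (\<lambda>n. 1 / fact n :: real) = \<infinity>"
  using fps_conv_radius_exp[of "1::real"] by (simp add: fps_conv_radius_def fps_exp_def)

lemma conv_radius_inverse_fact_Suc: "conv_radius (\<lambda>n. 1 / fact (n + 1) :: real) = \<infinity>"
  using conv_radius_shift[of "\<lambda>n. 1 / fact n :: real" 1] conv_radius_inverse_fact by simp

lemma summable_power_weighted:
  fixes a :: "nat \<Rightarrow> real"
  assumes "0 \<le> r" "ereal r < conv_radius a"
  shows "summable (\<lambda>n. \<bar>a n\<bar> * r ^ n)"
  using abs_summable_in_conv_radius[of r a] assms by (simp add: abs_mult)

lemma summable_power_deriv_weighted:
  fixes a :: "nat \<Rightarrow> real"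
  assumes "0 \<le> r" "ereal r < conv_radius a"
  shows "summable (\<lambda>n. \<bar>a n\<bar> * (real n * r ^ (n - 1)))"
proof -
  obtain q where q: "r < q" "ereal q < conv_radius a"
    using ereal_dense2[OF assms(2)] by auto
  have "summable (\<lambda>n. \<bar>a n\<bar> * x ^ n)" if "norm x < q" for x
  proof -
    have "summable (\<lambda>n. norm (\<bar>a n\<bar> * x ^ n))"
      using abs_summable_in_conv_radius[of x a] that q(2)
      by (simp add: abs_mult) (metis ereal_less_eq(3) less_imp_le order_le_less_trans)
    then show ?thesis
      by (rule summable_norm_cancel)
  qed
  then have "summable (\<lambda>n. diffs (\<lambda>n. \<bar>a n\<bar>) n * r ^ n)"
    using assms(1) q(1) by (intro termdiff_converges[of r q]) auto
  then have "summable (\<lambda>n. \<bar>a (Suc n)\<bar> * (real (Suc n) * r ^ (Suc n - 1)))"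
    by (simp add: diffs_def mult_ac)
  then show ?thesis
    by (subst (asm) summable_Suc_iff)
qed

text \<open>
  A single constant serves as a bound for the bilinear product and for the norm of the identity
  matrix. It spoils the growth rate by a factor, so these bounds suit entire series only.
\<close>

lemma norm_matrix_power_bounds:
  obtains K where "K > 0"
    "\<And>(A :: real ^ 'n ^ 'n) n. norm (matrix_power A n) \<le> K * (K * norm A) ^ n"
    "\<And>(A :: real ^ 'n ^ 'n) H n.
       norm (matrix_power_deriv A H n) \<le> real n * (K * norm A) ^ (n - 1) * (K ^ 4 * norm H)"
proof -
  obtain K0 where K0: "K0 > 0"
    "\<And>(A :: real ^ 'n ^ 'n) (B :: real ^ 'n ^ 'n). norm (A ** B) \<le> norm A * norm B * K0"
    using matrix_mult.pos_bounded by blast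
  define K where "K = max K0 (norm (mat 1 :: real ^ 'n ^ 'n))"
  have "K > 0"
    using K0(1) by (simp add: K_def less_max_iff_disj)
  have mult: "norm (A ** B) \<le> K * norm A * norm B" for A B :: "real ^ 'n ^ 'n"
  proof -
    have "norm A * norm B * K0 \<le> norm A * norm B * K"
      by (intro mult_left_mono) (auto simp: K_def)
    with K0(2)[of A B] show ?thesis
      by (simp add: mult_ac)
  qed
  have pow: "norm (matrix_power A n) \<le> K * (K * norm A) ^ n" for A :: "real ^ 'n ^ 'n" and n
  proof (induction n)
    case 0
    show ?case by (simp add: K_def)
  next
    case (Suc n)
    have "norm (matrix_power A (Suc n)) \<le> K * norm A * norm (matrix_power A n)"
      using mult by simp
    also have "\<dots> \<le> K * norm A * (K * (K * norm A) ^ n)"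
      using Suc \<open>K > 0\<close> by (intro mult_left_mono) auto
    finally show ?case
      by (simp add: mult_ac)
  qed
  have "norm (matrix_power_deriv A H n) \<le> real n * (K * norm A) ^ (n - 1) * (K ^ 4 * norm H)"
    for A H :: "real ^ 'n ^ 'n" and n
  proof -
    have "norm (matrix_power A j ** H ** matrix_power A (n - Suc j))
        \<le> (K * norm A) ^ (n - 1) * (K ^ 4 * norm H)" if "j < n" for j
    proof -
      have "norm (matrix_power A j ** H ** matrix_power A (n - Suc j))
          \<le> K * (K * norm (matrix_power A j) * norm H) * norm (matrix_power A (n - Suc j))"
        using \<open>K > 0\<close> by (intro order_trans[OF mult] mult_right_mono mult_left_mono mult) auto
      also have "\<dots> \<le> K * (K * (K * (K * norm A) ^ j) * norm H) * (K * (K * norm A) ^ (n - Suc j))"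
        using \<open>K > 0\<close> by (intro mult_mono mult_left_mono mult_right_mono pow mult_nonneg_nonneg) auto
      also have "\<dots> = (K * norm A) ^ (j + (n - Suc j)) * (K ^ 4 * norm H)"
        by (simp add: power_add power4_eq_xxxx mult_ac)
      finally show ?thesis
        using that by simp
    qed
    then have "norm (matrix_power_deriv A H n) \<le> (\<Sum>j<n. (K * norm A) ^ (n - 1) * (K ^ 4 * norm H))"
      unfolding matrix_power_deriv_def by (intro sum_norm_le) auto
    then show ?thesis
      by simp
  qed
  with \<open>K > 0\<close> pow show ?thesis
    by (rule that)
qed

lemma summable_norm_entire_matrix_series:
  fixes A :: "real ^ 'n ^ 'n"
  assumes "conv_radius a = \<infinity>"
  shows "summable (\<lambda>n. norm (a n *\<^sub>R matrix_power A n))"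
proof -
  obtain K where K: "K > 0"
    "\<And>(A :: real ^ 'n ^ 'n) n. norm (matrix_power A n) \<le> K * (K * norm A) ^ n"
    using norm_matrix_power_bounds by metis
  have "summable (\<lambda>n. \<bar>a n\<bar> * (K * norm A) ^ n)"
    using K(1) assms by (intro summable_power_weighted) auto
  then have "summable (\<lambda>n. \<bar>a n\<bar> * (K * norm A) ^ n * K)"
    by (rule summable_mult2)
  then show ?thesis
  proof (rule summable_comparison_test')
    show "norm (norm (a n *\<^sub>R matrix_power A n)) \<le> \<bar>a n\<bar> * (K * norm A) ^ n * K" for n
      using mult_left_mono[OF K(2)[of A n], of "\<bar>a n\<bar>"] by (simp add: mult_ac)
  qed
qed

section \<open>The matrix exponential\<close>

lemma has_derivative_matrix_exp:
  fixes A :: "real ^ 'n ^ 'n"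
  shows "(matrix_exp has_derivative
    (\<lambda>H. \<Sum>n. (1 / fact n) *\<^sub>R matrix_power_deriv A H n)) (at A)"
proof -
  obtain K where K: "K > 0"
    "\<And>(A :: real ^ 'n ^ 'n) H n.
       norm (matrix_power_deriv A H n) \<le> real n * (K * norm A) ^ (n - 1) * (K ^ 4 * norm H)"
    using norm_matrix_power_bounds by metis
  define r where "r = norm A + 1"
  define M where "M n = \<bar>1 / fact n\<bar> * (real n * (K * r) ^ (n - 1)) * K ^ 4" for n
  have "((\<lambda>A. \<Sum>n. (1 / fact n) *\<^sub>R matrix_power A n) has_derivative
      (\<lambda>H. \<Sum>n. (1 / fact n) *\<^sub>R matrix_power_deriv A H n)) (at A)"
  proof (rule has_derivative_series_M_test[where S = "ball 0 r" and M = M])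
    show "((\<lambda>A. (1 / fact n) *\<^sub>R matrix_power A n) has_derivative
        (\<lambda>H. (1 / fact n) *\<^sub>R matrix_power_deriv B H n)) (at B)" for n and B :: "real ^ 'n ^ 'n"
      by (intro has_derivative_scaleR_right has_derivative_matrix_power)
    show "summable M"
      unfolding M_def
      by (intro summable_mult2 summable_power_deriv_weighted)
        (use K(1) conv_radius_inverse_fact in \<open>auto simp: r_def\<close>)
    show "summable (\<lambda>n. (1 / fact n) *\<^sub>R matrix_power A n)"
      by (rule summable_norm_cancel[OF summable_norm_entire_matrix_series[OF conv_radius_inverse_fact]])
    show "norm ((1 / fact n) *\<^sub>R matrix_power_deriv B H n) \<le> M n * norm H"
      if "B \<in> ball 0 r" for n and B H :: "real ^ 'n ^ 'n"
    proof -
      have "norm (matrix_power_deriv B H n) \<le> real n * (K * norm B) ^ (n - 1) * (K ^ 4 * norm H)"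
        by (rule K(2))
      also have "\<dots> \<le> real n * (K * r) ^ (n - 1) * (K ^ 4 * norm H)"
        using that K(1) by (intro mult_right_mono mult_left_mono power_mono) auto
      finally have "\<bar>1 / fact n\<bar> * norm (matrix_power_deriv B H n)
          \<le> \<bar>1 / fact n\<bar> * (real n * (K * r) ^ (n - 1) * (K ^ 4 * norm H))"
        by (rule mult_left_mono) simp
      then show ?thesis
        by (simp add: M_def mult_ac)
    qed
  qed (auto simp: r_def)
  then show ?thesis
    by (simp add: matrix_exp_def[abs_def])
qed

lemma matrix_exp_right_inverse:
  fixes A :: "real ^ 'n ^ 'n"
  shows "matrix_exp A ** matrix_inv (matrix_exp A) = mat 1"
proof -
  have eq: "matrix_exp A = matrix_series (\<lambda>n. 1 / fact n) A"
    by (simp add: matrix_exp_def matrix_series_def)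
  \<comment> \<open>The inverse is the exponential of \<open>- A\<close>, written as a power series in \<open>A\<close> itself.\<close>
  have radius: "conv_radius (\<lambda>n. (- 1) ^ n / fact n :: real) = \<infinity>"
    using conv_radius_norm[of "\<lambda>n. (- 1) ^ n / fact n :: real"] conv_radius_inverse_fact
    by (simp add: abs_divide)
  have conv: "(\<Sum>k\<le>n. 1 / fact k * ((- 1) ^ (n - k) / fact (n - k))) =
      (if n = 0 then 1 else 0 :: real)" for n
    using exp_series_add_commuting[of "1::real" "- 1" n, symmetric]
    by (cases "n = 0") (simp_all add: divide_inverse mult_ac)
  have "matrix_exp A ** matrix_series (\<lambda>n. (- 1) ^ n / fact n) A = mat 1"
    unfolding eq
    by (intro matrix_series_mult_inverse summable_norm_entire_matrix_series
        conv_radius_inverse_fact radius conv)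
  then show ?thesis
    using matrix_inv_eqI by metis
qed

text \<open>
  Dividing the binomial expansion by \<open>(n+1)!\<close> splits its coefficient into \<open>1/(k+1)!\<close> and \<open>1/(n-k)!\<close>,
  which exhibits the derivative of the exponential as a Cauchy product. The factor \<open>exp A\<close> on the
  right is the one that the right trivialization removes.
\<close>

lemma matrix_exp_derivative_sums:
  fixes A :: "real ^ 'n ^ 'n"
  assumes \<beta>: "\<And>k. \<beta> (Suc k) = A ** \<beta> k - \<beta> k ** A"
    and summable: "summable (\<lambda>k. norm ((1 / fact (k + 1)) *\<^sub>R \<beta> k))"
  shows "(\<lambda>n. (1 / fact n) *\<^sub>R matrix_power_deriv A (\<beta> 0) n) sums
    ((\<Sum>k. (1 / fact (k + 1)) *\<^sub>R \<beta> k) ** matrix_exp A)"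
proof -
  have term_eq: "(\<Sum>k\<le>n. ((1 / fact (k + 1)) *\<^sub>R \<beta> k) ** ((1 / fact (n - k)) *\<^sub>R matrix_power A (n - k))) =
      (1 / fact (Suc n)) *\<^sub>R matrix_power_deriv A (\<beta> 0) (Suc n)" for n
    unfolding matrix_power_deriv_commutators[of \<beta>, OF \<beta>] scaleR_sum_right
  proof (rule sum.cong[OF refl])
    fix k assume "k \<in> {..n}"
    then have "1 / fact (Suc n) * real (Suc n choose Suc k) = 1 / fact (k + 1) * (1 / fact (n - k))"
      using binomial_fact[of "Suc k" "Suc n", where 'a = real] by simp
    then show "((1 / fact (k + 1)) *\<^sub>R \<beta> k) ** ((1 / fact (n - k)) *\<^sub>R matrix_power A (n - k)) =
        (1 / fact (Suc n)) *\<^sub>R real (Suc n choose Suc k) *\<^sub>R (\<beta> k ** matrix_power A (n - k))"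
      by (simp only: matrix_mult.scaleR_left matrix_mult.scaleR_right scaleR_scaleR mult_ac)
  qed
  have "(\<lambda>n. (1 / fact (Suc n)) *\<^sub>R matrix_power_deriv A (\<beta> 0) (Suc n)) sums
      ((\<Sum>k. (1 / fact (k + 1)) *\<^sub>R \<beta> k) ** matrix_exp A)"
    using Cauchy_product_matrix[OF summable
        summable_norm_entire_matrix_series[OF conv_radius_inverse_fact, of A]]
    unfolding term_eq matrix_exp_def .
  from sums_Suc[OF this] show ?thesis
    by simp
qed

section \<open>The exponential of SE(3)\<close>

lemma bounded_linear_se3_hat: "bounded_linear se3_hat"
proof -
  have "se3_hat (X + Y) = se3_hat X + se3_hat Y" for X Y
    unfolding vec_eq_iff split_sum_all forall_3
    by (simp add: se3_hat_def ang_def lin_def block_matrix_def skew_def matrix_def cross3_def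
        axis_def vector_3)
  moreover have "se3_hat (c *\<^sub>R X) = c *\<^sub>R se3_hat X" for c X
    unfolding vec_eq_iff split_sum_all forall_3
    by (simp add: se3_hat_def ang_def lin_def block_matrix_def skew_def matrix_def cross3_def
        axis_def vector_3)
  ultimately have "linear se3_hat"
    by (rule linearI)
  then show ?thesis
    by (simp add: linear_conv_bounded_linear)
qed

lemma bounded_linear_ad: "bounded_linear ad"
proof -
  have "ad (X + Y) = ad X + ad Y" for X Y
    unfolding vec_eq_iff split_sum_all forall_3
    by (simp add: ad_def ang_def lin_def block_matrix_def skew_def matrix_def cross3_def
        axis_def vector_3)
  moreover have "ad (c *\<^sub>R X) = c *\<^sub>R ad X" for c X
    unfolding vec_eq_iff split_sum_all forall_3
    by (simp add: ad_def ang_def lin_def block_matrix_def skew_def matrix_def cross3_def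
        axis_def vector_3)
  ultimately have "linear ad"
    by (rule linearI)
  then show ?thesis
    by (simp add: linear_conv_bounded_linear)
qed

text \<open>
  Antisymmetry and the Jacobi identity are inherited from the commutator of \<open>4 \<times> 4\<close> matrices.
\<close>

lemma ad_skew: "ad X *v Y = - (ad Y *v X)"
proof (rule injD[OF inj_se3_hat])
  show "se3_hat (ad X *v Y) = se3_hat (- (ad Y *v X))"
    by (simp add: linear_neg[OF bounded_linear.linear[OF bounded_linear_se3_hat]] se3_hat_ad)
qed

lemma ad_ad: "ad (ad X *v Y) = ad X ** ad Y - ad Y ** ad X"
proof -
  have "ad (ad X *v Y) *v W = ad X *v (ad Y *v W) - ad Y *v (ad X *v W)" for W
  proof (rule injD[OF inj_se3_hat])
    show "se3_hat (ad (ad X *v Y) *v W) = se3_hat (ad X *v (ad Y *v W) - ad Y *v (ad X *v W))"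
      by (simp add: linear_diff[OF bounded_linear.linear[OF bounded_linear_se3_hat]] se3_hat_ad
          matrix_mult.diff_left matrix_mult.diff_right matrix_mul_assoc)
  qed
  then show ?thesis
    by (simp add: matrix_eq matrix_vec.diff_left matrix_vector_mul_assoc)
qed

lemma has_derivative_SE3_exp:
  "(SE3_exp has_derivative
    (\<lambda>U. se3_hat (matrix_series (\<lambda>n. 1 / fact (n + 1)) (ad X) *v U) ** SE3_exp X)) (at X)"
proof -
  let ?c = "\<lambda>n. 1 / fact (n + 1) :: real"
  have sum_eq: "(\<Sum>n. (1 / fact n) *\<^sub>R matrix_power_deriv (se3_hat X) (se3_hat U) n) =
      se3_hat (matrix_series ?c (ad X) *v U) ** SE3_exp X" for U
  proof -
    define \<beta> where "\<beta> k = se3_hat (matrix_power (ad X) k *v U)" for k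
    define L where "L A = se3_hat (A *v U)" for A :: mat6
    have L: "bounded_linear L"
      unfolding L_def
      by (rule bounded_linear_compose[OF bounded_linear_se3_hat matrix_vec.bounded_linear_left])
    have L_term: "L (?c k *\<^sub>R matrix_power (ad X) k) = ?c k *\<^sub>R \<beta> k" for k
      unfolding linear_cmul[OF bounded_linear.linear[OF L]] by (simp add: L_def \<beta>_def)
    have summable: "summable (\<lambda>k. norm (?c k *\<^sub>R matrix_power (ad X) k))"
      by (rule summable_norm_entire_matrix_series[OF conv_radius_inverse_fact_Suc])
    obtain K where K: "\<And>A. norm (L A) \<le> norm A * K"
      using bounded_linear.bounded[OF L] by blast
    have "summable (\<lambda>k. norm (?c k *\<^sub>R \<beta> k))"
      unfolding L_term[symmetric]
      by (rule summable_comparison_test'[OF summable_mult2[OF summable, of K]])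
        (use K in \<open>simp only: real_norm_def abs_norm_cancel\<close>)
    moreover have "\<beta> (Suc k) = se3_hat X ** \<beta> k - \<beta> k ** se3_hat X" for k
      by (simp add: \<beta>_def se3_hat_ad flip: matrix_vector_mul_assoc)
    ultimately have "(\<lambda>n. (1 / fact n) *\<^sub>R matrix_power_deriv (se3_hat X) (\<beta> 0) n) sums
        ((\<Sum>k. ?c k *\<^sub>R \<beta> k) ** matrix_exp (se3_hat X))"
      by (intro matrix_exp_derivative_sums)
    moreover have "(\<Sum>k. ?c k *\<^sub>R \<beta> k) = se3_hat (matrix_series ?c (ad X) *v U)"
      using bounded_linear.suminf[OF L summable_norm_cancel[OF summable]]
      unfolding L_term by (simp add: L_def matrix_series_def)
    moreover have "\<beta> 0 = se3_hat U"
      by (simp add: \<beta>_def)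
    ultimately show ?thesis
      by (simp add: sums_iff SE3_exp_def)
  qed
  have "((\<lambda>Y. matrix_exp (se3_hat Y)) has_derivative
      (\<lambda>U. \<Sum>n. (1 / fact n) *\<^sub>R matrix_power_deriv (se3_hat X) (se3_hat U) n)) (at X)"
    by (rule has_derivative_compose[OF bounded_linear_imp_has_derivative[OF bounded_linear_se3_hat]
          has_derivative_matrix_exp])
  then show ?thesis
    unfolding sum_eq by (simp add: SE3_exp_def[abs_def])
qed

lemma dexp_eq_series: "dexp X = matrix_series (\<lambda>n. 1 / fact (n + 1)) (ad X)"
proof -
  have "frechet_derivative SE3_exp (at X) =
      (\<lambda>U. se3_hat (matrix_series (\<lambda>n. 1 / fact (n + 1)) (ad X) *v U) ** SE3_exp X)"
    using frechet_derivative_at[OF has_derivative_SE3_exp] by simp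
  then have "frechet_derivative SE3_exp (at X) U ** matrix_inv (SE3_exp X) =
      se3_hat (matrix_series (\<lambda>n. 1 / fact (n + 1)) (ad X) *v U)" for U
    by (simp add: SE3_exp_def matrix_exp_right_inverse flip: matrix_mul_assoc)
  then show ?thesis
    by (simp add: dexp_def inv_f_f[OF inj_se3_hat])
qed

section \<open>A weighted norm adapted to the adjoint representation\<close>

text \<open>
  The scaling \<open>(x, y) \<mapsto> (x, s y)\<close> is an automorphism of the Lie algebra se(3). Measuring vectors
  after this scaling makes the contribution of the linear part arbitrarily small while the bracket
  stays submultiplicative, because the bracket has no term quadratic in the linear parts.
\<close>

definition weighted_norm :: "real \<Rightarrow> vec6 \<Rightarrow> real" where
  "weighted_norm s v = norm (ang v) + s * norm (lin v)"

lemma norm_vec6: "(norm v)\<^sup>2 = (norm (ang v))\<^sup>2 + (norm (lin v))\<^sup>2"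
  by (simp add: norm_vec_def L2_set_def ang_def lin_def sum_UNIV_sum_type sum_nonneg)

lemma weighted_norm_nonneg: "0 \<le> s \<Longrightarrow> 0 \<le> weighted_norm s v"
  by (simp add: weighted_norm_def)

lemma norm_ang_le: "norm (ang v) \<le> norm v" and norm_lin_le: "norm (lin v) \<le> norm v"
  using norm_vec6[of v] by (auto intro: power2_le_imp_le)

lemma weighted_norm_le:
  assumes "0 \<le> s" "s \<le> 1"
  shows "weighted_norm s v \<le> 2 * norm v"
  using norm_ang_le[of v] mult_mono[OF assms(2) norm_lin_le[of v]] by (simp add: weighted_norm_def)

lemma norm_le_weighted_norm:
  assumes "0 < s" "s \<le> 1"
  shows "norm v \<le> weighted_norm s v / s"
proof -
  have "(norm v)\<^sup>2 \<le> (norm (ang v) + norm (lin v))\<^sup>2"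
    by (simp add: norm_vec6 power2_sum)
  then have "norm v \<le> norm (ang v) + norm (lin v)"
    by (rule power2_le_imp_le) simp
  moreover have "s * norm (ang v) \<le> norm (ang v)"
    using assms by (simp add: mult_left_le_one_le)
  ultimately have "s * norm v \<le> weighted_norm s v"
    using mult_left_mono[of "norm v" "norm (ang v) + norm (lin v)" s] assms
    by (simp add: weighted_norm_def distrib_left)
  then show ?thesis
    using assms by (simp add: pos_le_divide_eq mult.commute)
qed

lemma weighted_norm_add:
  assumes "0 \<le> s"
  shows "weighted_norm s (u + v) \<le> weighted_norm s u + weighted_norm s v"
proof -
  have "ang (u + v) = ang u + ang v" "lin (u + v) = lin u + lin v"
    by (simp_all add: ang_def lin_def vec_eq_iff)
  moreover have "s * norm (lin u + lin v) \<le> s * (norm (lin u) + norm (lin v))"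
    by (intro mult_left_mono norm_triangle_ineq assms)
  ultimately show ?thesis
    using norm_triangle_ineq[of "ang u" "ang v"] by (simp add: weighted_norm_def distrib_left)
qed

lemma weighted_norm_scaleR: "weighted_norm s (c *\<^sub>R v) = \<bar>c\<bar> * weighted_norm s v"
proof -
  have "ang (c *\<^sub>R v) = c *\<^sub>R ang v" "lin (c *\<^sub>R v) = c *\<^sub>R lin v"
    by (simp_all add: ang_def lin_def vec_eq_iff)
  then show ?thesis
    by (simp add: weighted_norm_def algebra_simps)
qed

lemma weighted_norm_sum:
  assumes "0 \<le> s"
  shows "weighted_norm s (\<Sum>i<n. f i) \<le> (\<Sum>i<(n::nat). weighted_norm s (f i))"
proof (induction n)
  case 0
  show ?case using weighted_norm_scaleR[of s 0 0] by simp
next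
  case (Suc n)
  then show ?case
    using weighted_norm_add[OF assms, of "\<Sum>i<n. f i" "f n"] by simp
qed

lemma norm_cross_le: "norm (cross3 x y) \<le> norm x * norm y"
proof (rule power2_le_imp_le)
  show "(norm (cross3 x y))\<^sup>2 \<le> (norm x * norm y)\<^sup>2"
    using norm_cross_dot[of x y] zero_le_power2[of "x \<bullet> y"] by linarith
qed simp

lemma weighted_norm_ad:
  assumes "0 \<le> s"
  shows "weighted_norm s (ad X *v v) \<le> weighted_norm s X * weighted_norm s v"
proof -
  have "norm (lin (ad X *v v)) \<le> norm (lin X) * norm (ang v) + norm (ang X) * norm (lin v)"
    unfolding lin_ad by (intro norm_triangle_le add_mono norm_cross_le)
  then have "s * norm (lin (ad X *v v)) \<le>
      s * (norm (lin X) * norm (ang v) + norm (ang X) * norm (lin v))"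
    by (intro mult_left_mono assms)
  moreover have "norm (ang (ad X *v v)) \<le> norm (ang X) * norm (ang v)"
    unfolding ang_ad by (rule norm_cross_le)
  moreover have "0 \<le> s * norm (lin X) * (s * norm (lin v))"
    using assms by simp
  ultimately show ?thesis
    by (simp add: weighted_norm_def algebra_simps)
qed

lemma weighted_norm_ad_power:
  assumes "0 \<le> s"
  shows "weighted_norm s (matrix_power (ad X) n *v v) \<le> weighted_norm s X ^ n * weighted_norm s v"
proof (induction n)
  case (Suc n)
  have "weighted_norm s (matrix_power (ad X) (Suc n) *v v) \<le>
      weighted_norm s X * weighted_norm s (matrix_power (ad X) n *v v)"
    using weighted_norm_ad[OF assms] by (simp flip: matrix_vector_mul_assoc)
  also have "\<dots> \<le> weighted_norm s X * (weighted_norm s X ^ n * weighted_norm s v)"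
    by (intro mult_left_mono Suc weighted_norm_nonneg assms)
  finally show ?case
    by (simp add: mult_ac)
qed simp

lemma weighted_norm_ad_power_deriv:
  assumes "0 \<le> s" "weighted_norm s Y \<le> r"
  shows "weighted_norm s (matrix_power_deriv (ad Y) (ad U) n *v v) \<le>
    real n * r ^ (n - 1) * (weighted_norm s U * weighted_norm s v)"
proof -
  note nonneg = weighted_norm_nonneg[OF assms(1)]
  have r: "0 \<le> r"
    using nonneg[of Y] assms(2) by linarith
  have power: "weighted_norm s (matrix_power (ad Y) k *v w) \<le> r ^ k * weighted_norm s w" for k w
    using assms nonneg
    by (intro order_trans[OF weighted_norm_ad_power[OF assms(1)]] mult_right_mono power_mono)
  have "weighted_norm s ((matrix_power (ad Y) j ** ad U ** matrix_power (ad Y) (n - Suc j)) *v v) \<le>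
      r ^ (n - 1) * (weighted_norm s U * weighted_norm s v)" if "j < n" for j
  proof -
    let ?w = "matrix_power (ad Y) (n - Suc j) *v v"
    have "weighted_norm s (matrix_power (ad Y) j *v (ad U *v ?w)) \<le>
        r ^ j * weighted_norm s (ad U *v ?w)"
      by (rule power)
    also have "\<dots> \<le> r ^ j * (weighted_norm s U * weighted_norm s ?w)"
      by (intro mult_left_mono weighted_norm_ad assms(1)) (use r in auto)
    also have "\<dots> \<le> r ^ j * (weighted_norm s U * (r ^ (n - Suc j) * weighted_norm s v))"
      by (intro mult_left_mono power nonneg) (use r in auto)
    also have "\<dots> = r ^ (j + (n - Suc j)) * (weighted_norm s U * weighted_norm s v)"
      by (simp add: power_add mult_ac)
    finally show ?thesis
      using that by (simp add: matrix_vector_mul_assoc matrix_mul_assoc)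
  qed
  then have "(\<Sum>j<n. weighted_norm s
        ((matrix_power (ad Y) j ** ad U ** matrix_power (ad Y) (n - Suc j)) *v v)) \<le>
      (\<Sum>j<n. r ^ (n - 1) * (weighted_norm s U * weighted_norm s v))"
    by (intro sum_mono) auto
  with weighted_norm_sum[OF assms(1)] show ?thesis
    unfolding matrix_power_deriv_def matrix_vec.sum_left
    by (fastforce intro: order_trans)
qed

lemma weighted_norm_close_to_ang:
  assumes "norm (ang X) < r"
  obtains s where "0 < s" "s \<le> 1" "weighted_norm s X < r"
proof -
  define s where "s = min 1 ((r - norm (ang X)) / (norm (lin X) + 1))"
  have pos: "0 < norm (lin X) + 1"
    by (smt (verit) norm_ge_zero)
  have "0 < s" "s \<le> 1"
    using assms pos by (auto simp: s_def)
  have "s * norm (lin X) < s * (norm (lin X) + 1)"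
    using \<open>0 < s\<close> by simp
  also have "\<dots> \<le> (r - norm (ang X)) / (norm (lin X) + 1) * (norm (lin X) + 1)"
    using pos by (intro mult_right_mono) (auto simp: s_def)
  also have "\<dots> = r - norm (ang X)"
    using pos by simp
  finally show ?thesis
    using that[OF \<open>0 < s\<close> \<open>s \<le> 1\<close>] by (simp add: weighted_norm_def)
qed

text \<open>
  The operator norm of \<open>ad\<^sub>X\<close> may exceed the radius of convergence; only its growth rate under
  iteration matters, and that is governed by the weighted norm for a suitable weight.
\<close>

lemma summable_norm_ad_series:
  assumes "ereal (norm (ang X)) < conv_radius a"
  shows "summable (\<lambda>n. norm (a n *\<^sub>R matrix_power (ad X) n))"
proof -
  obtain r where r: "norm (ang X) < r" "ereal r < conv_radius a"
    using ereal_dense2[OF assms] by auto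
  obtain s where s: "0 < s" "s \<le> 1" "weighted_norm s X < r"
    using weighted_norm_close_to_ang[OF r(1)] .
  have "0 \<le> weighted_norm s X"
    using s by (intro weighted_norm_nonneg) simp
  with s(3) have "0 \<le> r"
    by linarith
  define C where "C = real CARD(3 + 3) * real CARD(3 + 3) * (2 / s)"
  have "0 \<le> C"
    using s(1) by (simp add: C_def)
  have bound: "norm (matrix_power (ad X) n) \<le> r ^ n * C" for n
  proof -
    have "norm (matrix_power (ad X) n *v v) \<le> r ^ n * (2 / s) * norm v" for v
    proof -
      have "norm (matrix_power (ad X) n *v v) \<le> weighted_norm s (matrix_power (ad X) n *v v) / s"
        using s by (intro norm_le_weighted_norm)
      also have "\<dots> \<le> (weighted_norm s X ^ n * weighted_norm s v) / s"
        using s by (intro divide_right_mono weighted_norm_ad_power) auto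
      also have "\<dots> \<le> (r ^ n * (2 * norm v)) / s"
        using s \<open>0 \<le> weighted_norm s X\<close> \<open>0 \<le> r\<close>
        by (intro divide_right_mono mult_mono power_mono weighted_norm_le weighted_norm_nonneg) auto
      finally show ?thesis
        by simp
    qed
    from norm_matrix_le[OF this] show ?thesis
      by (simp add: C_def mult_ac)
  qed
  have "summable (\<lambda>n. \<bar>a n\<bar> * r ^ n * C)"
    by (intro summable_mult2 summable_power_weighted \<open>0 \<le> r\<close> r(2))
  then show ?thesis
  proof (rule summable_comparison_test')
    show "norm (norm (a n *\<^sub>R matrix_power (ad X) n)) \<le> \<bar>a n\<bar> * r ^ n * C" for n
      using mult_left_mono[OF bound[of n], of "\<bar>a n\<bar>"] by (simp add: mult_ac)
  qed
qed

section \<open>Differentiating a power series in the adjoint representation\<close>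

text \<open>
  Antisymmetry moves the direction \<open>U\<close> from the middle of the word to its right end, so that the
  remaining factors form a matrix acting on \<open>U\<close>.
\<close>

lemma matrix_power_deriv_ad_eq_PP:
  "matrix_power_deriv (ad X) (ad U) n *v Z = (\<Sum>j<n. PP n j X Z) *v U"
proof -
  have "(matrix_power (ad X) j ** ad U ** matrix_power (ad X) (n - Suc j)) *v Z = PP n j X Z *v U"
    for j
  proof -
    have "(matrix_power (ad X) j ** ad U ** matrix_power (ad X) (n - Suc j)) *v Z =
        P j X *v (ad U *v Zs (n - j - 1) X Z)"
      by (simp add: P_def Zs_def matrix_vector_mul_assoc matrix_mul_assoc)
    also have "\<dots> = P j X *v (- (ad (Zs (n - j - 1) X Z) *v U))"
      by (subst ad_skew) simp
    also have "\<dots> = PP n j X Z *v U"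
      by (simp add: PP_def matrix_vec.minus_left matrix_vec.minus_right matrix_vector_mul_assoc)
    finally show ?thesis .
  qed
  then show ?thesis
    by (simp add: matrix_power_deriv_def matrix_vec.sum_left)
qed

lemma has_derivative_ad_series:
  assumes "ereal (norm (ang X)) < conv_radius a"
  obtains J where "(\<lambda>i. a i *\<^sub>R (\<Sum>j<i. PP i j X Z)) sums J"
    "((\<lambda>Y. matrix_series a (ad Y) *v Z) has_derivative (\<lambda>U. J *v U)) (at X)"
proof -
  obtain r where r: "norm (ang X) < r" "ereal r < conv_radius a"
    using ereal_dense2[OF assms] by auto
  obtain s where s: "0 < s" "s \<le> 1" "weighted_norm s X < r"
    using weighted_norm_close_to_ang[OF r(1)] .
  have "0 \<le> r"
    using weighted_norm_nonneg[of s X] s by linarith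
  define S where "S = {Y. weighted_norm s Y < r}"
  have ang_S: "ereal (norm (ang Y)) < conv_radius a" if "Y \<in> S" for Y
  proof -
    have "0 \<le> s * norm (lin Y)"
      using s(1) by simp
    with that have "norm (ang Y) < r"
      unfolding S_def weighted_norm_def by simp
    with r(2) show ?thesis
      by (meson ereal_less(3) less_ereal.simps(1) less_trans)
  qed
  have summable: "summable (\<lambda>n. a n *\<^sub>R matrix_power (ad Y) n)" if "Y \<in> S" for Y
    using summable_norm_ad_series[OF ang_S[OF that]] by (rule summable_norm_cancel)
  define f where "f n Y = a n *\<^sub>R (matrix_power (ad Y) n *v Z)" for n Y
  define f' where "f' n Y U = a n *\<^sub>R (matrix_power_deriv (ad Y) (ad U) n *v Z)" for n Y U
  \<comment> \<open>The factor \<open>2 / s\<close> compares the weighted norm with the Euclidean one in both directions.\<close>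
  define M where "M n = \<bar>a n\<bar> * (real n * r ^ (n - 1)) * (2 * weighted_norm s Z / s)" for n
  have S: "convex S" "open S" "X \<in> S"
  proof -
    show "convex S"
      unfolding convex_def S_def
    proof (clarsimp)
      fix x y and u v :: real
      assume *: "weighted_norm s x < r" "weighted_norm s y < r" "0 \<le> u" "0 \<le> v" "u + v = 1"
      have "weighted_norm s (u *\<^sub>R x + v *\<^sub>R y) \<le> u * weighted_norm s x + v * weighted_norm s y"
        using weighted_norm_add[of s "u *\<^sub>R x" "v *\<^sub>R y"] s(1) * by (simp add: weighted_norm_scaleR)
      also have "\<dots> < r"
        using * by (intro convex_bound_lt)
      finally show "weighted_norm s (u *\<^sub>R x + v *\<^sub>R y) < r" .
    qed
    show "open S"
      unfolding S_def weighted_norm_def ang_def lin_def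
      by (intro open_Collect_less continuous_intros)
    show "X \<in> S"
      using s(3) by (simp add: S_def)
  qed
  have deriv: "((\<lambda>Y. \<Sum>n. f n Y) has_derivative (\<lambda>U. \<Sum>n. f' n X U)) (at X)"
    and summable_f': "\<And>U. summable (\<lambda>n. f' n X U)"
  proof -
    have M: "summable M"
      unfolding M_def by (intro summable_mult2 summable_power_deriv_weighted \<open>0 \<le> r\<close> r(2))
    have bound: "norm (f' n Y U) \<le> M n * norm U" if "Y \<in> S" for n Y U
    proof -
      have "norm (matrix_power_deriv (ad Y) (ad U) n *v Z) \<le>
          weighted_norm s (matrix_power_deriv (ad Y) (ad U) n *v Z) / s"
        using s by (intro norm_le_weighted_norm)
      also have "\<dots> \<le> (real n * r ^ (n - 1) * (weighted_norm s U * weighted_norm s Z)) / s"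
        using s that by (intro divide_right_mono weighted_norm_ad_power_deriv) (auto simp: S_def)
      also have "\<dots> \<le> (real n * r ^ (n - 1) * (2 * norm U * weighted_norm s Z)) / s"
        using s \<open>0 \<le> r\<close> weighted_norm_nonneg[of s Z]
        by (intro divide_right_mono mult_left_mono mult_right_mono weighted_norm_le) auto
      finally have "\<bar>a n\<bar> * norm (matrix_power_deriv (ad Y) (ad U) n *v Z) \<le>
          \<bar>a n\<bar> * ((real n * r ^ (n - 1) * (2 * norm U * weighted_norm s Z)) / s)"
        by (rule mult_left_mono) simp
      then show ?thesis
        by (simp add: f'_def M_def mult_ac)
    qed
    show "((\<lambda>Y. \<Sum>n. f n Y) has_derivative (\<lambda>U. \<Sum>n. f' n X U)) (at X)"
    proof (rule has_derivative_series_M_test[OF S _ bound M])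
      show "(f n has_derivative f' n Y) (at Y)" for n Y
      proof -
        have "((\<lambda>Y. matrix_power (ad Y) n) has_derivative
            (\<lambda>U. matrix_power_deriv (ad Y) (ad U) n)) (at Y)"
          by (rule has_derivative_compose[OF bounded_linear_imp_has_derivative[OF bounded_linear_ad]
                has_derivative_matrix_power])
        from bounded_linear.has_derivative[OF matrix_vec.bounded_linear_left[of Z] this]
        show ?thesis
          unfolding f_def[abs_def] f'_def[abs_def] by (rule has_derivative_scaleR_right)
      qed
      show "summable (\<lambda>n. f n X)"
        using bounded_linear.summable[OF matrix_vec.bounded_linear_left[of Z] summable[OF S(3)]]
        by (simp add: f_def matrix_vec.scaleR_left)
    qed
    show "summable (\<lambda>n. f' n X U)" for U
      by (rule summable_comparison_test'[OF summable_mult2[OF M, of "norm U"]])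
        (use bound[OF S(3)] in simp)
  qed
  define J where "J = matrix (\<lambda>U. \<Sum>n. f' n X U)"
  have J: "J *v U = (\<Sum>n. f' n X U)" for U
    unfolding J_def
    using fun_cong[OF matrix_vector_mul(3)[OF has_derivative_bounded_linear[OF deriv]]] .
  show ?thesis
  proof
    show "(\<lambda>i. a i *\<^sub>R (\<Sum>j<i. PP i j X Z)) sums J"
    proof (rule sums_entrywise)
      fix i k
      have "(\<lambda>n. f' n X (axis k 1)) sums (J *v axis k 1)"
        unfolding J by (rule summable_sums[OF summable_f'])
      then have "(\<lambda>n. f' n X (axis k 1) $ i) sums ((J *v axis k 1) $ i)"
        by (rule bounded_linear.sums[OF bounded_linear_vec_nth])
      then show "(\<lambda>n. (a n *\<^sub>R (\<Sum>j<n. PP n j X Z)) $ i $ k) sums (J $ i $ k)"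
        unfolding f'_def matrix_power_deriv_ad_eq_PP
        by (simp add: matrix_vector_mult_basis column_def)
    qed
    have "(\<Sum>n. f n Y) = matrix_series a (ad Y) *v Z" if "Y \<in> S" for Y
      using bounded_linear.suminf[OF matrix_vec.bounded_linear_left[of Z] summable[OF that]]
      by (simp add: f_def matrix_series_def matrix_vec.scaleR_left)
    from has_derivative_transform_within_open[OF deriv S(2,3) this]
    show "((\<lambda>Y. matrix_series a (ad Y) *v Z) has_derivative (\<lambda>U. J *v U)) (at X)"
      unfolding J .
  qed
qed

lemma has_derivative_imp_has_jacobian:
  assumes "(f has_derivative (\<lambda>U. J *v U)) (at X)"
  shows "has_jacobian f J X"
  unfolding has_jacobian_def
proof
  fix U
  have line: "((\<lambda>t. X + t *\<^sub>R U) has_derivative (\<lambda>t. t *\<^sub>R U)) (at 0)"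
    by (auto intro!: derivative_eq_intros)
  have "((\<lambda>t. f (X + t *\<^sub>R U)) has_derivative (\<lambda>t. J *v (t *\<^sub>R U))) (at 0)"
    by (rule has_derivative_compose[OF line]) (use assms in simp)
  then show "((\<lambda>t. f (X + t *\<^sub>R U)) has_vector_derivative J *v U) (at 0)"
    by (simp add: has_vector_derivative_def matrix_vec.scaleR_right)
qed

section \<open>The Bernoulli series\<close>

text \<open>
  After multiplication by \<open>(n+1)!\<close> this is the recursion that defines the Bernoulli numbers.
\<close>

lemma bernoulli_convolution:
  "(\<Sum>k\<le>n. 1 / fact (k + 1) * (bernoulli (n - k) / fact (n - k))) = (if n = 0 then 1 else 0)"
proof -
  have "(\<Sum>k\<le>n. 1 / fact (k + 1) * (bernoulli (n - k) / fact (n - k))) =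
      (\<Sum>k\<le>n. 1 / fact (n - k + 1) * (bernoulli k / fact k))"
    by (rule sum.reindex_bij_witness[of _ "\<lambda>k. n - k" "\<lambda>k. n - k"]) auto
  also have "\<dots> = (\<Sum>k\<le>n. real (Suc n choose k) * bernoulli k) / fact (Suc n)"
    unfolding sum_divide_distrib
    by (intro sum.cong refl) (simp add: binomial_fact Suc_diff_le del: fact_Suc)
  also have "(\<Sum>k\<le>n. real (Suc n choose k) * bernoulli k) = (if n = 0 then 1 else 0)"
  proof (cases "n = 0")
    case False
    have "real (Suc n) * bernoulli n = - (\<Sum>k<n. real (Suc n choose k) * bernoulli k)"
      by (subst bernoulli.simps) (use False in \<open>simp add: field_simps del: binomial_Suc_Suc\<close>)
    then show ?thesis
      using False by (simp add: lessThan_Suc_atMost[symmetric])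
  qed (simp add: bernoulli_values)
  finally show ?thesis
    by simp
qed

text \<open>
  The function \<open>(exp z - 1) / z\<close> vanishes only at the nonzero multiples of \<open>2\<pi>\<i>\<close>. A reciprocal power
  series converges up to the nearest zero; this is a theorem about complex functions, hence the
  detour through complex coefficients.
\<close>

lemma conv_radius_bernoulli: "conv_radius (\<lambda>n. bernoulli n / fact n) \<ge> ereal (2 * pi)"
proof -
  define E :: "complex fps" where "E = fps_shift 1 (fps_exp 1 - 1)"
  define B :: "complex fps" where "B = Abs_fps (\<lambda>n. of_real (bernoulli n / fact n))"
  have E_nth: "fps_nth E n = of_real (1 / fact (n + 1))" for n
    by (simp add: E_def algebra_simps)
  have E_radius: "fps_conv_radius E = \<infinity>"
    using fps_conv_radius_diff[of "fps_exp 1 :: complex fps" 1] by (simp add: E_def)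
  have "E * B = 1"
  proof (rule fps_ext)
    fix n
    have "fps_nth (E * B) n =
        of_real (\<Sum>k\<le>n. 1 / fact (k + 1) * (bernoulli (n - k) / fact (n - k)))"
      by (simp add: fps_mult_nth E_nth B_def atLeast0AtMost del: fact_Suc)
    then show "fps_nth (E * B) n = fps_nth 1 n"
      unfolding bernoulli_convolution by simp
  qed
  then have B_eq: "inverse E = B"
    by (rule fps_inverse_unique)
  have nonzero: "eval_fps E z \<noteq> 0" if "z \<in> eball 0 (ereal (2 * pi))" for z
  proof (cases "z = 0")
    case True
    then show ?thesis by (simp add: eval_fps_at_0 E_nth)
  next
    case False
    have "norm z < 2 * pi"
      using that by simp
    have "exp z \<noteq> 1"
    proof
      assume "exp z = 1"
      then obtain n :: int where n: "Re z = 0" "Im z = of_int (2 * n) * pi"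
        unfolding exp_eq_1 by blast
      then have "norm z = 2 * pi * \<bar>of_int n\<bar>"
        by (simp add: cmod_eq_Im abs_mult)
      moreover have "n \<noteq> 0"
        using n False by (auto simp: complex_eq_iff)
      then have "1 \<le> \<bar>of_int n :: real\<bar>"
        by linarith
      then have "2 * pi * 1 \<le> 2 * pi * \<bar>of_int n :: real\<bar>"
        by (intro mult_left_mono) auto
      ultimately show False
        using \<open>norm z < 2 * pi\<close> by linarith
    qed
    have "fps_conv_radius (fps_exp 1 - 1 :: complex fps) = \<infinity>"
      using E_radius by (simp add: E_def)
    have "fps_exp 1 - 1 \<noteq> (0 :: complex fps)"
      using E_nth[of 0] by (auto simp: E_def)
    then have "1 \<le> subdegree (fps_exp 1 - 1 :: complex fps)"
      by (intro subdegree_geI) auto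
    then have "eval_fps E z = (exp z - 1) / z"
      unfolding E_def using False \<open>fps_conv_radius (fps_exp 1 - 1 :: complex fps) = \<infinity>\<close>
      by (subst eval_fps_shift) (auto simp: eval_fps_diff)
    with False \<open>exp z \<noteq> 1\<close> show ?thesis by simp
  qed
  have "min (ereal (2 * pi)) (fps_conv_radius E) \<le> fps_conv_radius (inverse E)"
    by (rule fps_conv_radius_inverse[OF nonzero]) (auto simp: E_radius E_nth)
  then have "ereal (2 * pi) \<le> conv_radius (\<lambda>n. of_real (bernoulli n / fact n) :: complex)"
    unfolding E_radius B_eq by (simp add: fps_conv_radius_def B_def)
  also have "\<dots> = conv_radius (\<lambda>n. bernoulli n / fact n)"
    by (rule conv_radius_cong) (simp add: norm_divide)
  finally show ?thesis .
qed

lemma dexp_inv_eq_series: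
  assumes "norm (ang X) < 2 * pi"
  shows "dexp_inv X = matrix_series (\<lambda>n. bernoulli n / fact n) (ad X)"
proof -
  have "ereal (norm (ang X)) < conv_radius (\<lambda>n. bernoulli n / fact n)"
    using assms conv_radius_bernoulli by (meson less_ereal.simps(1) order_less_le_trans)
  then have "dexp X ** matrix_series (\<lambda>n. bernoulli n / fact n) (ad X) = mat 1"
    unfolding dexp_eq_series
    by (intro matrix_series_mult_inverse bernoulli_convolution summable_norm_ad_series
        summable_norm_entire_matrix_series conv_radius_inverse_fact_Suc)
  then show ?thesis
    unfolding dexp_inv_def by (rule matrix_inv_eqI)
qed

section \<open>The recursion and the Jacobians of the evaluation maps\<close>

lemma PP_recursion:
  assumes "j + 2 \<le> i"
  shows "PP i j X Z = ad X ** PP (i - 1) j X Z + P j X ** ad (Zs (i - j - 2) X Z) ** ad X"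
proof -
  have "i - j - 1 = Suc (i - j - 2)" "i - 1 - j - 1 = i - j - 2"
    using assms by auto
  then have "Zs (i - j - 1) X Z = ad X *v Zs (i - j - 2) X Z"
    by (simp add: Zs_def P_def matrix_vector_mul_assoc)
  then show ?thesis
    unfolding PP_def \<open>i - 1 - j - 1 = i - j - 2\<close>
    by (simp add: ad_ad matrix_mult.diff_right matrix_mult.minus_right matrix_mul_assoc P_def
        matrix_power_commute)
qed

theorem lemma7:
  fixes X Z :: vec6
  shows "(\<exists>J. (\<lambda>i. (1 / fact (i + 1)) *\<^sub>R (\<Sum>j<i. PP i j X Z)) sums J
              \<and> has_jacobian (\<lambda>Y. dexp Y *v Z) J X)
    \<and> (norm (ang X) < 2 * pi \<longrightarrow>
         (\<exists>J. (\<lambda>i. (bernoulli i / fact i) *\<^sub>R (\<Sum>j<i. PP i j X Z)) sums J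
              \<and> has_jacobian (\<lambda>Y. dexp_inv Y *v Z) J X))
    \<and> (\<forall>i j. j + 2 \<le> i \<longrightarrow>
         PP i j X Z = ad X ** PP (i - 1) j X Z + P j X ** ad (Zs (i - j - 2) X Z) ** ad X)"
proof (intro conjI impI allI)
  obtain J where "(\<lambda>i. (1 / fact (i + 1)) *\<^sub>R (\<Sum>j<i. PP i j X Z)) sums J"
    "((\<lambda>Y. dexp Y *v Z) has_derivative (\<lambda>U. J *v U)) (at X)"
    using has_derivative_ad_series[of X "\<lambda>i. 1 / fact (i + 1)" Z] conv_radius_inverse_fact_Suc
    unfolding dexp_eq_series by auto
  then show "\<exists>J. (\<lambda>i. (1 / fact (i + 1)) *\<^sub>R (\<Sum>j<i. PP i j X Z)) sums J
      \<and> has_jacobian (\<lambda>Y. dexp Y *v Z) J X"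
    using has_derivative_imp_has_jacobian by blast
next
  assume X: "norm (ang X) < 2 * pi"
  then have "ereal (norm (ang X)) < conv_radius (\<lambda>n. bernoulli n / fact n)"
    using conv_radius_bernoulli by (meson less_ereal.simps(1) order_less_le_trans)
  then obtain J where sums: "(\<lambda>i. (bernoulli i / fact i) *\<^sub>R (\<Sum>j<i. PP i j X Z)) sums J"
    and deriv: "((\<lambda>Y. matrix_series (\<lambda>n. bernoulli n / fact n) (ad Y) *v Z) has_derivative
      (\<lambda>U. J *v U)) (at X)"
    by (rule has_derivative_ad_series)
  have "open {Y. norm (ang Y) < 2 * pi}"
    unfolding ang_def by (intro open_Collect_less continuous_intros)
  with deriv have "((\<lambda>Y. dexp_inv Y *v Z) has_derivative (\<lambda>U. J *v U)) (at X)"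
    by (rule has_derivative_transform_within_open) (use X in \<open>auto simp: dexp_inv_eq_series\<close>)
  with sums show "\<exists>J. (\<lambda>i. (bernoulli i / fact i) *\<^sub>R (\<Sum>j<i. PP i j X Z)) sums J
      \<and> has_jacobian (\<lambda>Y. dexp_inv Y *v Z) J X"
    using has_derivative_imp_has_jacobian by blast
next
  fix i j :: nat
  assume "j + 2 \<le> i"
  then show "PP i j X Z = ad X ** PP (i - 1) j X Z + P j X ** ad (Zs (i - j - 2) X Z) ** ad X"
    by (rule PP_recursion)
qed

end
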